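(* Let $(\mathcal{M},d_{\mathcal{M}})$ and $(\mathcal{N},d_{\mathcal{N}})$ be geodesic metric spaces. Suppose $X\subseteq\mathcal{M}$ is a compact and geodesically convex set, and $Y\subseteq\mathcal{N}$ is a geodesically convex set. Let $f:X\times Y\to\mathbb{R}$ be a function such that (1) for every $y\in Y$, $f(\cdot,y)$ is geodesically quasi-convex and lower semi-continuous on $X$; and (2) for every $x\in X$, $f(x,\cdot)$ is geodesically quasi-concave and upper semi-continuous on $Y$. Then $$\min_{x\in X}\sup_{y\in Y} f(x,y)=\sup_{y\in Y}\min_{x\in X} f(x,y).$$
   Context: Let $(\mathcal{M},d)$ be a metric space. A map $\gamma:[0,1]\to\mathcal{M}$ is a geodesic joining $x,y\in\mathcal{M}$ if $\gamma(0)=x$, $\gamma(1)=y$ and $d(\gamma(t_1),\gamma(t_2))=|t_2-t_1|\,d(x,y)$ for all $t_1,t_2\in[0,1]$. The space is a geodesic metric space if any two of its points are joined by a geodesic (not necessarily unique). A non-empty subset $X\subseteq\mathcal{M}$ is geodesically convex if every geodesic connecting two points of $X$ lies completely in $X$. A function $h:X\to\mathbb{R}$ on a geodesically convex set $X$ is geodesically quasi-convex if for all $x,y\in X$, every geodesic $\gamma$ with $\gamma(0)=x$, $\gamma(1)=y$, and every $t\in[0,1]$, $h(\gamma(t))\le\max\{h(x),h(y)\}$; $h$ is geodesically quasi-concave if $-h$ is geodesically quasi-convex. Suprema are taken in the extended reals. *)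

theory Defs
  imports "HOL-Analysis.Analysis"
begin

text \<open>Only the values of a curve on \<open>{0..1}\<close> matter, although its type is total.\<close>

definition geodesic_joining :: "(real \<Rightarrow> 'a::metric_space) \<Rightarrow> 'a \<Rightarrow> 'a \<Rightarrow> bool" where
  "geodesic_joining \<gamma> x y \<longleftrightarrow>
     \<gamma> 0 = x \<and> \<gamma> 1 = y \<and>
     (\<forall>t1\<in>{0..1}. \<forall>t2\<in>{0..1}. dist (\<gamma> t1) (\<gamma> t2) = \<bar>t2 - t1\<bar> * dist x y)"

class geodesic_metric_space = metric_space +
  assumes geodesic_exists: "\<exists>\<gamma>. geodesic_joining \<gamma> x y"

text \<open>Normed spaces are geodesic: affine segments are geodesics.\<close>

lemma geodesic_joining_segment:
  fixes x y :: "'a::real_normed_vector"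
  shows "geodesic_joining (\<lambda>t. x + t *\<^sub>R (y - x)) x y"
proof -
  have "dist (x + s *\<^sub>R (y - x)) (x + t *\<^sub>R (y - x)) = \<bar>t - s\<bar> * dist x y" for s t :: real
  proof -
    have "(x + s *\<^sub>R (y - x)) - (x + t *\<^sub>R (y - x)) = (t - s) *\<^sub>R (x - y)"
      by (simp add: algebra_simps)
    then show ?thesis by (simp add: dist_norm)
  qed
  then show ?thesis by (simp add: geodesic_joining_def)
qed

instance real :: geodesic_metric_space
  by standard (use geodesic_joining_segment in blast)

definition geodesically_convex :: "'a::metric_space set \<Rightarrow> bool" where
  "geodesically_convex S \<longleftrightarrow>
     S \<noteq> {} \<and>
     (\<forall>x\<in>S. \<forall>y\<in>S. \<forall>\<gamma>. geodesic_joining \<gamma> x y \<longrightarrow> (\<forall>t\<in>{0..1}. \<gamma> t \<in> S))"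

definition geodesically_quasi_convex_on ::
    "'a::metric_space set \<Rightarrow> ('a \<Rightarrow> real) \<Rightarrow> bool" where
  "geodesically_quasi_convex_on S h \<longleftrightarrow>
     (\<forall>x\<in>S. \<forall>y\<in>S. \<forall>\<gamma>. geodesic_joining \<gamma> x y \<longrightarrow>
        (\<forall>t\<in>{0..1}. h (\<gamma> t) \<le> max (h x) (h y)))"

definition geodesically_quasi_concave_on ::
    "'a::metric_space set \<Rightarrow> ('a \<Rightarrow> real) \<Rightarrow> bool" where
  "geodesically_quasi_concave_on S h \<longleftrightarrow> geodesically_quasi_convex_on S (\<lambda>x. - h x)"

text \<open>Semicontinuity is relative to the subspace topology of \<open>S\<close>.\<close>

definition lower_semicontinuous_on ::
    "'a::topological_space set \<Rightarrow> ('a \<Rightarrow> real) \<Rightarrow> bool" where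
  "lower_semicontinuous_on S h \<longleftrightarrow>
     (\<forall>a\<in>S. \<forall>c<h a. \<forall>\<^sub>F x in at a within S. c < h x)"

definition upper_semicontinuous_on ::
    "'a::topological_space set \<Rightarrow> ('a \<Rightarrow> real) \<Rightarrow> bool" where
  "upper_semicontinuous_on S h \<longleftrightarrow>
     (\<forall>a\<in>S. \<forall>c>h a. \<forall>\<^sub>F x in at a within S. h x < c)"

definition is_min_on :: "'a set \<Rightarrow> ('a \<Rightarrow> ereal) \<Rightarrow> ereal \<Rightarrow> bool" where
  "is_min_on S g m \<longleftrightarrow> m \<in> g ` S \<and> (\<forall>x\<in>S. m \<le> g x)"

end

theory Submission
  imports Defs
begin

text \<open>The proof follows the elementary route to Sion's minimax theorem due to Komiya, which
  needs connectedness where the classical proofs use separation of convex sets or a fixed point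
  theorem.  A geodesic joins any two points of a geodesically convex set inside that set, so every
  sublevel set of \<open>f(\<cdot>, y)\<close>, being geodesically convex, is connected.  On the other side,
  quasi-concavity along a geodesic from \<open>y\<^sub>1\<close> to \<open>y\<^sub>2\<close> traps the sublevel sets of the intermediate
  functions in the union of the two sublevel sets at the ends.

  Let \<open>w = sup\<^sub>y min\<^sub>x f\<close>.  The inequality \<open>w \<le> sup\<^sub>y f(x, y)\<close> holds for every \<open>x\<close>, so it suffices to
  find one \<open>x\<close> with \<open>f(x, y) \<le> w\<close> for all \<open>y\<close>, that is, a common point of the closed sets
  \<open>{x. f(x, y) \<le> c}\<close> over all \<open>y\<close> and all real \<open>c > w\<close>.  By compactness of \<open>X\<close> only finitely many of
  them matter.  If finitely many had no common point, then at every \<open>x\<close> one of finitely many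
  functions \<open>f(\<cdot>, y\<^sub>i)\<close> would exceed a level \<open>c > w\<close>; the lemma
  \<open>finitely_many_points_replaceable\<close> then gives a single \<open>y\<close> for which \<open>f(\<cdot>, y)\<close> exceeds a level still
  above \<open>w\<close> on all of \<open>X\<close>, against the definition of \<open>w\<close>.  That lemma is an induction
  whose step is the case of two points, \<open>two_points_replaceable\<close>, where the connectedness argument
  takes place.\<close>

lemma lower_semicontinuous_on_subset:
  assumes "lower_semicontinuous_on S h" and "T \<subseteq> S"
  shows "lower_semicontinuous_on T h"
  unfolding lower_semicontinuous_on_def
proof (intro ballI allI impI)
  fix a c assume "a \<in> T" "c < h a"
  then have "\<forall>\<^sub>F x in at a within S. c < h x"
    using assms unfolding lower_semicontinuous_on_def by blast
  moreover have "at a within T \<le> at a within S"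
    using assms(2) by (rule at_le)
  ultimately show "\<forall>\<^sub>F x in at a within T. c < h x"
    by (rule filter_leD[rotated])
qed

lemma openin_strict_superlevel:
  assumes "lower_semicontinuous_on S h"
  shows "openin (top_of_set S) {x \<in> S. c < h x}"
proof (subst openin_subopen, intro ballI)
  fix a assume a: "a \<in> {x \<in> S. c < h x}"
  with assms have "\<forall>\<^sub>F x in at a within S. c < h x"
    unfolding lower_semicontinuous_on_def by blast
  then obtain T where T: "open T" "a \<in> T" "\<forall>x\<in>T. x \<noteq> a \<longrightarrow> x \<in> S \<longrightarrow> c < h x"
    unfolding eventually_at_topological by blast
  show "\<exists>U. openin (top_of_set S) U \<and> a \<in> U \<and> U \<subseteq> {x \<in> S. c < h x}"
  proof (intro exI conjI)
    show "openin (top_of_set S) (S \<inter> T)"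
      using T(1) by (rule openin_open_Int)
    show "a \<in> S \<inter> T" using a T by auto
    show "S \<inter> T \<subseteq> {x \<in> S. c < h x}" using a T by auto
  qed
qed

lemma closedin_sublevel:
  assumes "lower_semicontinuous_on S h"
  shows "closedin (top_of_set S) {x \<in> S. h x \<le> c}"
proof -
  have "S - {x \<in> S. c < h x} = {x \<in> S. h x \<le> c}" by auto
  then show ?thesis
    using closedin_diff[OF closedin_subtopology_refl[THEN iffD2] openin_strict_superlevel[OF assms, of c]]
    by simp
qed

lemma openin_strict_sublevel:
  assumes "upper_semicontinuous_on S h"
  shows "openin (top_of_set S) {x \<in> S. h x < c}"
proof -
  have "lower_semicontinuous_on S (\<lambda>x. - h x)"
    unfolding lower_semicontinuous_on_def
  proof (intro ballI allI impI)
    fix a d assume "a \<in> S" "d < - h a"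
    then have "\<forall>\<^sub>F x in at a within S. h x < - d"
      using assms unfolding upper_semicontinuous_on_def by simp
    then show "\<forall>\<^sub>F x in at a within S. d < - h x"
      by (rule eventually_mono) simp
  qed
  from openin_strict_superlevel[OF this, of "- c"] show ?thesis by simp
qed

lemma geodesic_continuous_on:
  assumes "geodesic_joining \<gamma> x y"
  shows "continuous_on {0..1} \<gamma>"
proof -
  have "dist (\<gamma> s) (\<gamma> t) = dist x y * dist s t" if "s \<in> {0..1}" "t \<in> {0..1}" for s t
    using assms that by (simp add: geodesic_joining_def dist_real_def abs_minus_commute)
  then have "(dist x y)-lipschitz_on {0..1} \<gamma>"
    by (intro lipschitz_onI) simp_all
  then show ?thesis by (rule lipschitz_on_continuous_on)
qed

lemma geodesically_convex_imp_connected: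
  fixes S :: "'a::geodesic_metric_space set"
  assumes "geodesically_convex S"
  shows "connected S"
proof (rule path_connected_imp_connected, unfold path_connected_def, intro ballI)
  fix x y assume xy: "x \<in> S" "y \<in> S"
  obtain \<gamma> where \<gamma>: "geodesic_joining \<gamma> x y" using geodesic_exists by blast
  show "\<exists>g. path g \<and> path_image g \<subseteq> S \<and> pathstart g = x \<and> pathfinish g = y"
  proof (intro exI conjI)
    show "path \<gamma>" unfolding path_def using \<gamma> by (rule geodesic_continuous_on)
    show "path_image \<gamma> \<subseteq> S"
      using assms xy \<gamma> unfolding geodesically_convex_def path_image_def by blast
    show "pathstart \<gamma> = x" "pathfinish \<gamma> = y"
      using \<gamma> by (simp_all add: geodesic_joining_def pathstart_def pathfinish_def)
  qed
qed

lemma geodesically_convex_sublevel: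
  assumes "geodesically_convex S" and "geodesically_quasi_convex_on S h"
    and "{x \<in> S. h x \<le> c} \<noteq> {}"
  shows "geodesically_convex {x \<in> S. h x \<le> c}"
  unfolding geodesically_convex_def
proof (intro conjI ballI allI impI)
  fix x y \<gamma> and t :: real
  assume xy: "x \<in> {x \<in> S. h x \<le> c}" "y \<in> {x \<in> S. h x \<le> c}"
    and \<gamma>: "geodesic_joining \<gamma> x y" and t: "t \<in> {0..1}"
  have "\<gamma> t \<in> S"
    using assms(1) xy \<gamma> t unfolding geodesically_convex_def by blast
  moreover have "h (\<gamma> t) \<le> max (h x) (h y)"
    using assms(2) xy \<gamma> t unfolding geodesically_quasi_convex_on_def by blast
  ultimately show "\<gamma> t \<in> {x \<in> S. h x \<le> c}" using xy by auto
qed (rule assms(3))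

lemma connected_sublevel:
  fixes S :: "'a::geodesic_metric_space set"
  assumes "geodesically_convex S" and "geodesically_quasi_convex_on S h"
  shows "connected {x \<in> S. h x \<le> c}"
proof (cases "{x \<in> S. h x \<le> c} = {}")
  case True
  then show ?thesis by (simp only: connected_empty)
next
  case False
  then show ?thesis
    by (intro geodesically_convex_imp_connected geodesically_convex_sublevel assms)
qed

lemma connected_subset_disjoint_closedin_Un:
  assumes "connected D" and "closedin (top_of_set X) A" and "closedin (top_of_set X) B"
    and "A \<inter> B = {}" and "D \<subseteq> A \<union> B"
  shows "D \<subseteq> A \<or> D \<subseteq> B"
proof (rule ccontr)
  assume neg: "\<not> (D \<subseteq> A \<or> D \<subseteq> B)"
  have "D \<subseteq> X"
    using assms(5) closedin_subset[OF assms(2)] closedin_subset[OF assms(3)] by auto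
  then have "closedin (top_of_set D) (D \<inter> A)" "closedin (top_of_set D) (D \<inter> B)"
    using assms(2,3) unfolding closedin_closed by blast+
  moreover have "D \<subseteq> (D \<inter> A) \<union> (D \<inter> B)" "(D \<inter> A) \<inter> (D \<inter> B) = {}"
    using assms(4,5) by auto
  moreover have "D \<inter> A \<noteq> {}" "D \<inter> B \<noteq> {}"
    using neg assms(5) by auto
  ultimately show False
    using assms(1) unfolding connected_closedin by blast
qed

text \<open>If no point of \<open>Y\<close> worked, every sublevel set at level \<open>\<alpha>\<close> would be non-empty.  Along a
  geodesic \<open>\<gamma>\<close> from \<open>y\<^sub>1\<close> to \<open>y\<^sub>2\<close> the sublevel sets at the higher level \<open>\<beta>\<close> are connected and
  covered by the two disjoint sublevel sets at the ends, hence each lies inside one of the two.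
  Upper semicontinuity in \<open>y\<close> prevents a jump from one to the other: a point at which
  \<open>f(\<cdot>, \<gamma> t) \<le> \<alpha>\<close> stays in the \<open>\<beta>\<close>-sublevel set for parameters near \<open>t\<close>, so that the gap between
  \<open>\<alpha>\<close> and \<open>\<beta>\<close> is what makes the argument work.  The unit interval would thus split into two
  non-empty disjoint open pieces.\<close>

lemma two_points_replaceable:
  fixes X :: "'m::geodesic_metric_space set"
    and Y :: "'n::geodesic_metric_space set"
    and f :: "'m \<Rightarrow> 'n \<Rightarrow> real"
  assumes X: "geodesically_convex X" and Y: "geodesically_convex Y"
    and qconv: "\<And>y. y \<in> Y \<Longrightarrow> geodesically_quasi_convex_on X (\<lambda>x. f x y)"
    and lsc: "\<And>y. y \<in> Y \<Longrightarrow> lower_semicontinuous_on X (\<lambda>x. f x y)"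
    and qconc: "\<And>x. x \<in> X \<Longrightarrow> geodesically_quasi_concave_on Y (\<lambda>y. f x y)"
    and usc: "\<And>x. x \<in> X \<Longrightarrow> upper_semicontinuous_on Y (\<lambda>y. f x y)"
    and y12: "y1 \<in> Y" "y2 \<in> Y" and "\<alpha> < \<beta>"
    and cover: "\<And>x. x \<in> X \<Longrightarrow> \<beta> < f x y1 \<or> \<beta> < f x y2"
  shows "\<exists>y\<in>Y. \<forall>x\<in>X. \<alpha> < f x y"
proof (rule ccontr)
  assume "\<not> ?thesis"
  then have low: "\<exists>x\<in>X. f x y \<le> \<alpha>" if "y \<in> Y" for y
    using that by (meson not_le)
  obtain \<gamma> where \<gamma>: "geodesic_joining \<gamma> y1 y2" using geodesic_exists by blast
  have \<gamma>Y: "\<gamma> t \<in> Y" if "t \<in> {0..1}" for t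
    using Y y12 \<gamma> that unfolding geodesically_convex_def by blast
  have ends: "\<gamma> 0 = y1" "\<gamma> 1 = y2" using \<gamma> by (auto simp: geodesic_joining_def)
  define L where "L y = {x \<in> X. f x y \<le> \<beta>}" for y
  have disj: "L y1 \<inter> L y2 = {}" using cover unfolding L_def by force
  have nonempty: "\<exists>x\<in>L y. f x y < \<beta>" if "y \<in> Y" for y
    using low[OF that] \<open>\<alpha> < \<beta>\<close> unfolding L_def by force
  have trapped: "L (\<gamma> t) \<subseteq> L y1 \<union> L y2" if "t \<in> {0..1}" for t
  proof
    fix x assume x: "x \<in> L (\<gamma> t)"
    then have "- f x (\<gamma> t) \<le> max (- f x y1) (- f x y2)"
      using qconc[of x] y12 \<gamma> that
      unfolding geodesically_quasi_concave_on_def geodesically_quasi_convex_on_def L_def by blast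
    with x show "x \<in> L y1 \<union> L y2" unfolding L_def by auto
  qed
  have dichotomy: "L (\<gamma> t) \<subseteq> L y1 \<or> L (\<gamma> t) \<subseteq> L y2" if "t \<in> {0..1}" for t
  proof (rule connected_subset_disjoint_closedin_Un)
    show "connected (L (\<gamma> t))"
      unfolding L_def by (intro connected_sublevel X qconv \<gamma>Y that)
    show "closedin (top_of_set X) (L y1)" "closedin (top_of_set X) (L y2)"
      unfolding L_def by (intro closedin_sublevel lsc y12)+
  qed (fact disj, rule trapped[OF that])
  have opened: "openin (top_of_set {0..1}) {t \<in> {0..1}. L (\<gamma> t) \<subseteq> A}"
    if AB: "A \<inter> B = {}" "\<And>t. t \<in> {0..1} \<Longrightarrow> L (\<gamma> t) \<subseteq> A \<or> L (\<gamma> t) \<subseteq> B" for A B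
  proof (subst openin_subopen, intro ballI)
    fix t assume t: "t \<in> {t \<in> {0..1}. L (\<gamma> t) \<subseteq> A}"
    then obtain x where x: "x \<in> L (\<gamma> t)" "f x (\<gamma> t) < \<beta>" using nonempty \<gamma>Y by blast
    then have "x \<in> X" "x \<in> A" using t by (auto simp: L_def)
    let ?U = "{0..1} \<inter> \<gamma> -` {y \<in> Y. f x y < \<beta>}"
    show "\<exists>U. openin (top_of_set {0..1}) U \<and> t \<in> U \<and> U \<subseteq> {t \<in> {0..1}. L (\<gamma> t) \<subseteq> A}"
    proof (intro exI conjI)
      show "openin (top_of_set {0..1}) ?U"
      proof (rule continuous_openin_preimage[where T = Y])
        show "continuous_on {0..1} \<gamma>" using \<gamma> by (rule geodesic_continuous_on)
        show "\<gamma> \<in> {0..1} \<rightarrow> Y" using \<gamma>Y by blast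
        show "openin (top_of_set Y) {y \<in> Y. f x y < \<beta>}"
          using usc[OF \<open>x \<in> X\<close>] by (rule openin_strict_sublevel)
      qed
      show "t \<in> ?U" using t x \<gamma>Y by auto
      show "?U \<subseteq> {t \<in> {0..1}. L (\<gamma> t) \<subseteq> A}"
      proof
        fix s assume s: "s \<in> ?U"
        then have "x \<in> L (\<gamma> s)" using \<open>x \<in> X\<close> by (auto simp: L_def)
        then have "\<not> L (\<gamma> s) \<subseteq> B" using \<open>x \<in> A\<close> AB(1) by auto
        then show "s \<in> {t \<in> {0..1}. L (\<gamma> t) \<subseteq> A}" using AB(2) s by auto
      qed
    qed
  qed
  let ?I = "\<lambda>A. {t \<in> {0..1::real}. L (\<gamma> t) \<subseteq> A}"
  have "openin (top_of_set {0..1}) (?I (L y1))"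
    using disj dichotomy by (rule opened)
  moreover have "openin (top_of_set {0..1}) (?I (L y2))"
  proof (rule opened)
    show "L y2 \<inter> L y1 = {}" using disj by auto
    show "L (\<gamma> t) \<subseteq> L y2 \<or> L (\<gamma> t) \<subseteq> L y1" if "t \<in> {0..1}" for t
      using dichotomy[OF that] by auto
  qed
  moreover have "{0..1} \<subseteq> ?I (L y1) \<union> ?I (L y2)" using dichotomy by blast
  moreover have "?I (L y1) \<inter> ?I (L y2) = {}"
    using nonempty[OF \<gamma>Y] disj by blast
  moreover have "0 \<in> ?I (L y1)" "1 \<in> ?I (L y2)" using ends by auto
  ultimately show False
    using connected_Icc[of 0 "1::real"] unfolding connected_openin by blast
qed

text \<open>To absorb one more point \<open>y\<close>, fix a level \<open>\<delta>\<close> strictly between \<open>\<alpha>\<close> and \<open>\<beta>\<close> and apply the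
  induction hypothesis on the set of those \<open>x\<close> that \<open>y\<close> does not lift above \<open>\<delta>\<close>.  This set is
  again geodesically convex unless it is empty, which is why \<open>X\<close> is generalized in the induction;
  the point found there and \<open>y\<close> are then merged by the case of two points, at the cost of
  descending from \<open>\<delta>\<close> to \<open>\<alpha>\<close>.\<close>

lemma finitely_many_points_replaceable:
  fixes X :: "'m::geodesic_metric_space set"
    and Y :: "'n::geodesic_metric_space set"
    and f :: "'m \<Rightarrow> 'n \<Rightarrow> real"
  assumes "finite F" and "F \<subseteq> Y" and Y: "geodesically_convex Y"
    and "geodesically_convex X"
    and "\<And>y. y \<in> Y \<Longrightarrow> geodesically_quasi_convex_on X (\<lambda>x. f x y)"
    and "\<And>y. y \<in> Y \<Longrightarrow> lower_semicontinuous_on X (\<lambda>x. f x y)"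
    and "\<And>x. x \<in> X \<Longrightarrow> geodesically_quasi_concave_on Y (\<lambda>y. f x y)"
    and "\<And>x. x \<in> X \<Longrightarrow> upper_semicontinuous_on Y (\<lambda>y. f x y)"
    and "\<alpha> < \<beta>" and "\<And>x. x \<in> X \<Longrightarrow> \<exists>y\<in>F. \<beta> < f x y"
  shows "\<exists>y\<in>Y. \<forall>x\<in>X. \<alpha> < f x y"
  using assms(1,2,4-)
proof (induction F arbitrary: X \<alpha> rule: finite_induct)
  case empty
  then show ?case using Y unfolding geodesically_convex_def by blast
next
  case (insert y F)
  have y: "y \<in> Y" and F: "F \<subseteq> Y" using insert.prems(1) by auto
  note X = insert.prems(2) and qconv = insert.prems(3) and lsc = insert.prems(4)
    and qconc = insert.prems(5) and usc = insert.prems(6) and cover = insert.prems(8)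
  obtain \<delta> where \<delta>: "\<alpha> < \<delta>" "\<delta> < \<beta>" using dense[OF insert.prems(7)] by blast
  let ?Z = "{x \<in> X. f x y \<le> \<delta>}"
  have ZX: "?Z \<subseteq> X" by blast
  have "\<exists>z\<in>Y. \<forall>x\<in>?Z. \<delta> < f x z"
  proof (cases "?Z = {}")
    case True
    then show ?thesis using y by blast
  next
    case False
    show ?thesis
    proof (rule insert.IH[OF F])
      show "geodesically_convex ?Z"
        using X qconv[OF y] False by (rule geodesically_convex_sublevel)
      show "geodesically_quasi_convex_on ?Z (\<lambda>x. f x z)" if "z \<in> Y" for z
        using qconv[OF that] unfolding geodesically_quasi_convex_on_def by blast
      show "lower_semicontinuous_on ?Z (\<lambda>x. f x z)" if "z \<in> Y" for z
        using lsc[OF that] ZX by (rule lower_semicontinuous_on_subset)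
      show "geodesically_quasi_concave_on Y (f x)" if "x \<in> ?Z" for x
        using that qconc by blast
      show "upper_semicontinuous_on Y (f x)" if "x \<in> ?Z" for x
        using that usc by blast
      show "\<exists>z\<in>F. \<beta> < f x z" if "x \<in> ?Z" for x
        using cover[of x] that \<delta> by auto
    qed (fact \<delta>(2))
  qed
  then obtain z where z: "z \<in> Y" "\<forall>x\<in>?Z. \<delta> < f x z" by blast
  show ?case
  proof (rule two_points_replaceable[OF X Y qconv lsc qconc usc y z(1) \<delta>(1)])
    show "\<delta> < f x y \<or> \<delta> < f x z" if "x \<in> X" for x
      using z(2) that by force
  qed
qed

lemma compact_sublevels_finite_intersection:
  fixes X :: "'a::metric_space set" and g :: "'i \<Rightarrow> 'a \<Rightarrow> real"
  assumes "compact X"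
    and lsc: "\<And>i. i \<in> I \<Longrightarrow> lower_semicontinuous_on X (g i)"
    and fin: "\<And>F. finite F \<Longrightarrow> F \<subseteq> I \<Longrightarrow> \<exists>x\<in>X. \<forall>i\<in>F. g i x \<le> c i"
  shows "\<exists>x\<in>X. \<forall>i\<in>I. g i x \<le> c i"
proof -
  have "X \<inter> (\<Inter>i\<in>I. {x \<in> X. g i x \<le> c i}) \<noteq> {}"
  proof (rule compact_imp_fip_image[OF \<open>compact X\<close>])
    show "closed {x \<in> X. g i x \<le> c i}" if "i \<in> I" for i
      using closedin_sublevel[OF lsc[OF that]] compact_imp_closed[OF \<open>compact X\<close>]
      by (rule closedin_closed_trans)
    show "X \<inter> (\<Inter>i\<in>F. {x \<in> X. g i x \<le> c i}) \<noteq> {}" if "finite F" "F \<subseteq> I" for F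
      using fin[OF that] by blast
  qed
  then show ?thesis by blast
qed

text \<open>A minimizer is a common point of the sublevel sets of \<open>h\<close> at all its own values; finitely
  many of these sets contain the point with the least of the chosen values.\<close>

lemma lower_semicontinuous_attains_min:
  fixes X :: "'a::metric_space set"
  assumes "compact X" and "X \<noteq> {}" and "lower_semicontinuous_on X h"
  shows "\<exists>x\<in>X. \<forall>a\<in>X. h x \<le> h a"
proof (rule compact_sublevels_finite_intersection[where g = "\<lambda>_. h"])
  show "\<exists>x\<in>X. \<forall>a\<in>F. h x \<le> h a" if "finite F" "F \<subseteq> X" for F
  proof (cases "F = {}")
    case True
    then show ?thesis using assms(2) by blast
  next
    case False
    then show ?thesis
      using that ex_is_arg_min_if_finite[of F h] by (auto simp: is_arg_min_linorder)
  qed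
qed (use assms in auto)

theorem theorem3p1:
  fixes X :: "'m::geodesic_metric_space set"
    and Y :: "'n::geodesic_metric_space set"
    and f :: "'m \<Rightarrow> 'n \<Rightarrow> real"
  assumes "compact X" and "geodesically_convex X"
    and "geodesically_convex Y"
    and "\<And>y. y \<in> Y \<Longrightarrow> geodesically_quasi_convex_on X (\<lambda>x. f x y)"
    and "\<And>y. y \<in> Y \<Longrightarrow> lower_semicontinuous_on X (\<lambda>x. f x y)"
    and "\<And>x. x \<in> X \<Longrightarrow> geodesically_quasi_concave_on Y (\<lambda>y. f x y)"
    and "\<And>x. x \<in> X \<Longrightarrow> upper_semicontinuous_on Y (\<lambda>y. f x y)"
  shows "\<exists>v m. is_min_on X (\<lambda>x. SUP y\<in>Y. ereal (f x y)) v \<and>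
               (\<forall>y\<in>Y. is_min_on X (\<lambda>x. ereal (f x y)) (m y)) \<and>
               v = (SUP y\<in>Y. m y)"
proof -
  have "X \<noteq> {}" using assms(2) by (simp add: geodesically_convex_def)
  have "\<forall>y\<in>Y. \<exists>a\<in>X. \<forall>x\<in>X. f a y \<le> f x y"
    using lower_semicontinuous_attains_min[OF assms(1) \<open>X \<noteq> {}\<close>] assms(5) by blast
  then obtain a where a: "\<And>y. y \<in> Y \<Longrightarrow> a y \<in> X \<and> (\<forall>x\<in>X. f (a y) y \<le> f x y)"
    by metis
  define m where "m y = ereal (f (a y) y)" for y
  define w where "w = (SUP y\<in>Y. m y)"
  have m: "is_min_on X (\<lambda>x. ereal (f x y)) (m y)" if "y \<in> Y" for y
    using a[OF that] by (auto simp: is_min_on_def m_def)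
  have weak: "w \<le> (SUP y\<in>Y. ereal (f x y))" if "x \<in> X" for x
    unfolding w_def m_def using a that by (intro SUP_mono) auto

  (* Ranging over the real levels above w treats infinite values of w as well. *)
  let ?I = "Y \<times> {c. w < ereal c}"
  have "\<exists>x\<in>X. \<forall>i\<in>?I. f x (fst i) \<le> snd i"
  proof (rule compact_sublevels_finite_intersection[OF assms(1)])
    show "lower_semicontinuous_on X (\<lambda>x. f x (fst i))" if "i \<in> ?I" for i
      using that assms(5) by auto
    fix F assume F: "finite F" "F \<subseteq> ?I"
    show "\<exists>x\<in>X. \<forall>i\<in>F. f x (fst i) \<le> snd i"
    proof (rule ccontr)
      assume neg: "\<not> ?thesis"
      then have "F \<noteq> {}" using \<open>X \<noteq> {}\<close> by blast
      define \<beta> where "\<beta> = Min (snd ` F)"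
      have "\<beta> \<in> snd ` F" unfolding \<beta>_def using F \<open>F \<noteq> {}\<close> by (intro Min_in) auto
      then have "w < ereal \<beta>" using F by auto
      then obtain \<alpha> where \<alpha>: "w < ereal \<alpha>" "\<alpha> < \<beta>"
        using ereal_dense2[of w "ereal \<beta>"] by auto
      have \<beta>le: "\<beta> \<le> snd i" if "i \<in> F" for i
        unfolding \<beta>_def using F that by (intro Min_le) auto
      have "\<exists>y\<in>Y. \<forall>x\<in>X. \<alpha> < f x y"
      proof (rule finitely_many_points_replaceable[OF _ _ assms(3,2,4-7) \<alpha>(2)])
        show "finite (fst ` F)" "fst ` F \<subseteq> Y" using F by auto
        show "\<exists>y\<in>fst ` F. \<beta> < f x y" if x: "x \<in> X" for x
        proof -
          have "\<exists>i\<in>F. snd i < f x (fst i)" using neg x by force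
          then obtain i where i: "i \<in> F" "snd i < f x (fst i)" by blast
          then have "\<beta> < f x (fst i)" using \<beta>le[of i] by simp
          with i(1) show ?thesis by blast
        qed
      qed
      then obtain y where y: "y \<in> Y" "\<forall>x\<in>X. \<alpha> < f x y" by blast
      then have "ereal \<alpha> < m y" using a[OF y(1)] by (simp add: m_def)
      also have "m y \<le> w" unfolding w_def using y(1) by (rule SUP_upper)
      finally show False using \<alpha> by simp
    qed
  qed
  then obtain x where x: "x \<in> X" "\<And>y c. y \<in> Y \<Longrightarrow> w < ereal c \<Longrightarrow> f x y \<le> c"
    by auto
  have "(SUP y\<in>Y. ereal (f x y)) \<le> w"
  proof (rule SUP_least, rule ccontr)
    fix y assume y: "y \<in> Y" and "\<not> ereal (f x y) \<le> w"
    then obtain c where "w < ereal c" "c < f x y"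
      using ereal_dense2[of w "ereal (f x y)"] by (auto simp: not_le)
    with x(2)[OF y] show False by force
  qed
  then have "w = (SUP y\<in>Y. ereal (f x y))" using weak[OF x(1)] by (rule antisym[rotated])
  then have "is_min_on X (\<lambda>x. SUP y\<in>Y. ereal (f x y)) w"
    using x(1) weak unfolding is_min_on_def by blast
  with m w_def show ?thesis by blast
qed

end
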